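(* Let $\theta$ be an ergodic aperiodic measure preserving transformation of a Lebesgue probability space $(X,\Sigma,\mu)$ and let $Tf=f\circ\theta$. Then for every $0<r<1$ there exists $f_r\in(I-T)L^r(\mu)$ such that the sequence $\frac1n\sum_{k=0}^{n-1}T^kf_r$ does not converge a.e.
   Context: For $0<r<1$, $L^r(\mu)=\{f \text{ measurable}:\int|f|^r d\mu<\infty\}$ (modulo a.e. equality), and $(I-T)L^r(\mu)=\{g-Tg: g\in L^r(\mu)\}$. Aperiodic means that the set of $x\in X$ with $\theta^n x=x$ for some $n\ge1$ has measure zero. *)

theory Defs
  imports "HOL-Probability.Probability"
begin

text \<open>
  Isomorphism of measure spaces in the strict sense; null sets are split off separately in
  the definition of a Lebesgue probability space.
\<close>

definition measure_isomorphism :: "('a \<Rightarrow> 'b) \<Rightarrow> 'a measure \<Rightarrow> 'b measure \<Rightarrow> bool" where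
  "measure_isomorphism \<phi> M N \<longleftrightarrow>
     bij_betw \<phi> (space M) (space N) \<and>
     \<phi> \<in> measurable M N \<and>
     the_inv_into (space M) \<phi> \<in> measurable N M \<and>
     distr M N \<phi> = N"

text \<open>
  A Lebesgue probability space in the sense of Rokhlin: a complete probability space that is,
  modulo a null set \<open>N\<close>, the disjoint union of an at most countable set \<open>A\<close> of atoms and a
  part \<open>C\<close> isomorphic to an interval of length \<open>measure M C\<close> with Lebesgue measure (on the
  Lebesgue measurable sets).  Both \<open>A\<close> and \<open>C\<close> may be empty.
\<close>

definition lebesgue_prob_space :: "'a measure \<Rightarrow> bool" where
  "lebesgue_prob_space M \<longleftrightarrow>
     prob_space M \<and> complete_measure M \<and>
     (\<exists>N A C \<phi>.
        N \<in> null_sets M \<and>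
        countable A \<and> (\<forall>a\<in>A. {a} \<in> sets M \<and> emeasure M {a} > 0) \<and>
        C \<in> sets M \<and>
        N \<inter> A = {} \<and> N \<inter> C = {} \<and> A \<inter> C = {} \<and> N \<union> A \<union> C = space M \<and>
        measure_isomorphism \<phi> (restrict_space M C) (lebesgue_on {0..<measure M C}))"

definition measure_preserving :: "'a measure \<Rightarrow> ('a \<Rightarrow> 'a) \<Rightarrow> bool" where
  "measure_preserving M \<theta> \<longleftrightarrow>
     \<theta> \<in> measurable M M \<and>
     (\<forall>A\<in>sets M. emeasure M (\<theta> -` A \<inter> space M) = emeasure M A)"

definition ergodic :: "'a measure \<Rightarrow> ('a \<Rightarrow> 'a) \<Rightarrow> bool" where
  "ergodic M \<theta> \<longleftrightarrow>
     (\<forall>A\<in>sets M. \<theta> -` A \<inter> space M = A \<longrightarrow> measure M A = 0 \<or> measure M A = 1)"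

definition aperiodic :: "'a measure \<Rightarrow> ('a \<Rightarrow> 'a) \<Rightarrow> bool" where
  "aperiodic M \<theta> \<longleftrightarrow> {x \<in> space M. \<exists>n\<ge>1. (\<theta> ^^ n) x = x} \<in> null_sets M"

definition koopman :: "('a \<Rightarrow> 'a) \<Rightarrow> ('a \<Rightarrow> real) \<Rightarrow> 'a \<Rightarrow> real" where
  "koopman \<theta> f = f \<circ> \<theta>"

text \<open>
  Elements of \<open>L\<^sup>r\<close> are represented by actual functions rather than by classes modulo
  a.e. equality.
\<close>

definition Lr_space :: "real \<Rightarrow> 'a measure \<Rightarrow> ('a \<Rightarrow> real) set" where
  "Lr_space r M =
     {f \<in> borel_measurable M. (\<integral>\<^sup>+x. ennreal (\<bar>f x\<bar> powr r) \<partial>M) < \<infinity>}"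

definition coboundaries :: "real \<Rightarrow> 'a measure \<Rightarrow> ('a \<Rightarrow> 'a) \<Rightarrow> ('a \<Rightarrow> real) set" where
  "coboundaries r M \<theta> = {(\<lambda>x. g x - koopman \<theta> g x) | g. g \<in> Lr_space r M}"

definition ergodic_average :: "('a \<Rightarrow> 'a) \<Rightarrow> ('a \<Rightarrow> real) \<Rightarrow> nat \<Rightarrow> 'a \<Rightarrow> real" where
  "ergodic_average \<theta> f n x = (1 / real n) * (\<Sum>k<n. (koopman \<theta> ^^ k) f x)"

end

theory Submission
  imports Defs
begin

text \<open>
  The averages of a coboundary telescope: for \<open>f = g - g \<circ> \<theta>\<close> the \<open>n\<close>-th average at \<open>x\<close> is
  \<open>(g x - g (\<theta>\<^sup>n x)) / n\<close>, so its convergence is that of \<open>g (\<theta>\<^sup>n x) / n\<close>.  If \<open>g\<close> were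
  integrable, this quotient would tend to \<open>0\<close> almost everywhere; below integrability there is room
  for a nonnegative \<open>g\<close> in \<open>L\<^sup>r\<close> such that, for almost every \<open>x\<close>, \<open>g (\<theta>\<^sup>n x) \<ge> n\<close> infinitely
  often.  On the other hand \<open>g\<close> is bounded by some \<open>K\<close> on a set of positive measure, and by
  ergodicity almost every orbit returns to that set infinitely often
  (\<open>AE_bounded_infinitely_often\<close>).  The quotient is then infinitely often at least \<open>1\<close> and
  infinitely often at most \<open>K / n\<close>, so it diverges almost everywhere.

  To build \<open>g\<close> one needs, for each \<open>N\<close>, a set \<open>E\<close> of measure at most \<open>2 / N\<close> that almost every
  orbit meets before time \<open>N\<close>.  Such a set comes from the hitting time \<open>\<tau>\<close> of a small
  set \<open>B\<close> of positive measure: \<open>E\<close> consists of the points at which \<open>\<tau>\<close> is a multiple of \<open>N\<close>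
  (\<open>small_sweeping_set\<close>).  This plays the role of Rokhlin's tower lemma, and it works for
  noninvertible maps too.  Putting the value \<open>N\<close> on \<open>E\<close> costs at most
  \<open>N\<^sup>r \<cdot> 2 / N = 2 N\<^sup>r\<^sup>-\<^sup>1\<close> in \<open>\<integral>\<bar>g\<bar>\<^sup>r\<close>, which is summable along a sparse sequence of values of \<open>N\<close>
  precisely because \<open>r < 1\<close> (\<open>Lr_function_with_large_orbit_values\<close>).

  Aperiodicity enters through the existence of the small sets \<open>B\<close>: an atom of positive measure would
  be a periodic point, so the space is an interval with Lebesgue measure up to a null set
  (\<open>small_sets_in_aperiodic_lebesgue_space\<close>).
\<close>

section \<open>Iterates of a measure preserving map\<close>

locale measure_preserving_system = prob_space M for M :: "'a measure" +
  fixes \<theta> :: "'a \<Rightarrow> 'a"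
  assumes measure_preserving: "measure_preserving M \<theta>"
begin

lemma measurable_iterate [measurable]: "\<theta> ^^ n \<in> measurable M M"
  using measure_preserving unfolding measure_preserving_def
  by (intro measurable_compose_n) auto

lemma iterate_in_space [simp]: "x \<in> space M \<Longrightarrow> (\<theta> ^^ n) x \<in> space M"
  using measurable_space[OF measurable_iterate] .

lemma vimage_iterate_sets [measurable]: "A \<in> sets M \<Longrightarrow> (\<theta> ^^ n) -` A \<inter> space M \<in> sets M"
  using measurable_sets[OF measurable_iterate] .

lemma emeasure_vimage_iterate:
  assumes "A \<in> sets M"
  shows "emeasure M ((\<theta> ^^ n) -` A \<inter> space M) = emeasure M A"
proof (induction n)
  case 0
  then show ?case using assms sets.sets_into_space by (simp add: Int_absorb2)
next
  case (Suc n)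
  have "(\<theta> ^^ Suc n) -` A \<inter> space M = \<theta> -` ((\<theta> ^^ n) -` A \<inter> space M) \<inter> space M"
    using iterate_in_space[of _ 1] by (auto simp: funpow_swap1)
  also have "emeasure M \<dots> = emeasure M ((\<theta> ^^ n) -` A \<inter> space M)"
    using measure_preserving vimage_iterate_sets[OF assms]
    unfolding measure_preserving_def by (elim conjE bspec)
  finally show ?case unfolding Suc .
qed

lemma measure_vimage_iterate:
  "A \<in> sets M \<Longrightarrow> measure M ((\<theta> ^^ n) -` A \<inter> space M) = measure M A"
  using emeasure_vimage_iterate by (simp add: measure_def)

lemma AE_all_iterates:
  assumes "AE x in M. P x"
  shows "AE x in M. \<forall>n. P ((\<theta> ^^ n) x)"
proof -
  obtain N where N: "N \<in> sets M" "emeasure M N = 0" "{x \<in> space M. \<not> P x} \<subseteq> N"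
    using assms by (auto elim!: AE_E)
  have "AE x in M. P ((\<theta> ^^ n) x)" for n
  proof (rule AE_I)
    show "{x \<in> space M. \<not> P ((\<theta> ^^ n) x)} \<subseteq> (\<theta> ^^ n) -` N \<inter> space M"
    proof
      fix x assume "x \<in> {x \<in> space M. \<not> P ((\<theta> ^^ n) x)}"
      then have "(\<theta> ^^ n) x \<in> {x \<in> space M. \<not> P x}" by simp
      then show "x \<in> (\<theta> ^^ n) -` N \<inter> space M" using N(3) \<open>x \<in> _\<close> by blast
    qed
  qed (use N emeasure_vimage_iterate[of N] in auto)
  then show ?thesis by (simp add: AE_all_countable)
qed

text \<open>
  A set that no orbit meets twice within \<open>N\<close> steps has \<open>N\<close> pairwise disjoint preimages of equal
  measure inside a probability space.
\<close>
lemma disjoint_preimages_bound: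
  assumes A: "A \<in> sets M"
    and no_return: "\<And>i j x. i < j \<Longrightarrow> j < N \<Longrightarrow> (\<theta> ^^ i) x \<in> A \<Longrightarrow> (\<theta> ^^ j) x \<notin> A"
  shows "real N * measure M A \<le> 1"
proof -
  have disj: "disjoint_family_on (\<lambda>i. (\<theta> ^^ i) -` A \<inter> space M) {..<N}"
    unfolding disjoint_family_on_def
  proof (intro ballI impI)
    fix i j assume "i \<in> {..<N}" "j \<in> {..<N}" "i \<noteq> j"
    then consider "i < j" "j < N" | "j < i" "i < N" by fastforce
    then show "((\<theta> ^^ i) -` A \<inter> space M) \<inter> ((\<theta> ^^ j) -` A \<inter> space M) = {}"
      by cases (auto dest: no_return)
  qed
  have "real N * measure M A = (\<Sum>i<N. measure M ((\<theta> ^^ i) -` A \<inter> space M))"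
    using A by (simp add: measure_vimage_iterate)
  also have "\<dots> = measure M (\<Union>i<N. (\<theta> ^^ i) -` A \<inter> space M)"
    using A disj by (intro finite_measure_finite_Union[symmetric]) auto
  also have "\<dots> \<le> 1" by (rule prob_le_1)
  finally show ?thesis .
qed

text \<open>
  Poincare recurrence for a single point: an orbit that meets \<open>a\<close> at two different times shows
  that \<open>a\<close> returns to itself.  Otherwise the preimages of \<open>{a}\<close> under all the iterates are pairwise
  disjoint and have the same positive measure.
\<close>
lemma positive_atom_periodic:
  assumes a: "{a} \<in> sets M" and pos: "measure M {a} > 0"
  shows "\<exists>n\<ge>1. (\<theta> ^^ n) a = a"
proof (rule ccontr)
  assume no: "\<not> ?thesis"
  have "(\<theta> ^^ j) x \<noteq> a" if "i < j" "(\<theta> ^^ i) x = a" for i j x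
  proof (rule ccontr)
    assume "\<not> ?thesis"
    then have "(\<theta> ^^ (j - i)) a = a"
      using that funpow_add[THEN fun_cong, of "j - i" i \<theta> x] by simp
    then show False using no that by auto
  qed
  then have "real N * measure M {a} \<le> 1" for N
    by (intro disjoint_preimages_bound[OF a]) auto
  moreover obtain N where "1 < real N * measure M {a}"
    using reals_Archimedean3[OF pos] by blast
  ultimately show False by (metis not_le)
qed

end

section \<open>Recurrence\<close>

locale ergodic_system = measure_preserving_system +
  assumes ergodic: "ergodic M \<theta>"
begin

text \<open>
  The points that visit \<open>B\<close> infinitely often form a strictly invariant set, so only its positive
  measure is at stake.  It is the decreasing limit of the sets of points that visit \<open>B\<close> at
  some time \<open>n \<ge> m\<close>; these are preimages of one another, hence all have the same measure, which is
  at least that of \<open>B\<close>.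
\<close>
lemma AE_visits_infinitely_often:
  assumes B: "B \<in> sets M" and pos: "measure M B > 0"
  shows "AE x in M. \<exists>\<^sub>\<infinity>n. (\<theta> ^^ n) x \<in> B"
proof -
  define D where "D m = (\<Union>n\<in>{m..}. (\<theta> ^^ n) -` B \<inter> space M)" for m
  have D_sets [measurable]: "D m \<in> sets M" for m
    unfolding D_def using B by auto
  have D_shift: "D m = (\<theta> ^^ m) -` D 0 \<inter> space M" for m
  proof -
    have "(\<exists>n\<ge>m. (\<theta> ^^ n) x \<in> B) \<longleftrightarrow> (\<exists>n. (\<theta> ^^ n) ((\<theta> ^^ m) x) \<in> B)" for x
    proof -
      have "(\<exists>n\<ge>m. (\<theta> ^^ n) x \<in> B) \<longleftrightarrow> (\<exists>n. (\<theta> ^^ (n + m)) x \<in> B)"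
        by (metis le_add2 le_add_diff_inverse2)
      then show ?thesis by (simp add: funpow_add)
    qed
    then have "x \<in> D m \<longleftrightarrow> x \<in> (\<theta> ^^ m) -` D 0 \<inter> space M" for x
      unfolding D_def by (auto simp: Bex_def)
    then show ?thesis by blast
  qed
  have inv: "\<theta> -` (\<Inter>m. D m) \<inter> space M = (\<Inter>m. D m)"
  proof -
    have mem: "x \<in> (\<Inter>m. D m) \<longleftrightarrow> x \<in> space M \<and> (\<exists>\<^sub>\<infinity>n. (\<theta> ^^ n) x \<in> B)" for x
      unfolding D_def by (auto simp: INFM_nat_le)
    have "(\<exists>\<^sub>\<infinity>n. (\<theta> ^^ n) (\<theta> x) \<in> B) \<longleftrightarrow> (\<exists>\<^sub>\<infinity>n. (\<theta> ^^ n) x \<in> B)" for x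
      using eventually_sequentially_Suc[of "\<lambda>n. (\<theta> ^^ n) x \<notin> B"]
      by (simp add: frequently_def cofinite_eq_sequentially funpow_swap1)
    then show ?thesis
      using iterate_in_space[of _ 1] unfolding set_eq_iff Int_iff vimage_eq mem by auto
  qed
  have "(\<lambda>m. measure M (D m)) \<longlonglongrightarrow> measure M (\<Inter>m. D m)"
  proof (rule finite_Lim_measure_decseq)
    show "range D \<subseteq> sets M" using D_sets by blast
    show "decseq D" unfolding decseq_def D_def by (intro allI impI UN_mono) auto
  qed
  moreover have "measure M (D m) = measure M (D 0)" for m
    using D_shift[of m] measure_vimage_iterate[OF D_sets[of 0], of m] by (simp only:)
  then have "(\<lambda>m. measure M (D m)) = (\<lambda>m. measure M (D 0))" by (rule ext)
  ultimately have "measure M (\<Inter>m. D m) = measure M (D 0)"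
    by (metis LIMSEQ_const_iff)
  moreover have "measure M B \<le> measure M (D 0)"
  proof (rule finite_measure_mono)
    show "B \<subseteq> D 0"
      unfolding D_def using sets.sets_into_space[OF B] by (auto intro!: exI[of _ 0])
  qed simp
  ultimately have "measure M (\<Inter>m. D m) = 1"
    using ergodic inv pos unfolding ergodic_def by (auto dest!: bspec[of _ _ "\<Inter>m. D m"])
  then have "AE x in M. x \<in> (\<Inter>m. D m)"
    by (intro prob_eq_1[THEN iffD1]) auto
  then show ?thesis by eventually_elim (auto simp: D_def INFM_nat_le)
qed

section \<open>Sets that are small and visited soon\<close>

text \<open>
  Let \<open>\<tau>\<close> be the time of the first visit to \<open>B\<close>, and let \<open>E\<close> be the set where \<open>\<tau>\<close> is a multiple
  of \<open>N\<close>.  Along an orbit \<open>\<tau>\<close> counts down by one at each step until it reaches \<open>0\<close>, so \<open>E\<close> is met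
  at time \<open>\<tau> mod N\<close>.  The part of \<open>E\<close> with \<open>\<tau> \<ge> N\<close> cannot be met twice within \<open>N\<close>
  steps, as \<open>\<tau>\<close> has decreased by less than \<open>N\<close> in between; so it has measure at most
  \<open>1 / N\<close>.  The rest of \<open>E\<close> has \<open>\<tau> = 0\<close>, that is, it lies in \<open>B\<close>.
\<close>
lemma small_sweeping_set:
  assumes B: "B \<in> sets M" and pos: "measure M B > 0" and N: "N > 0"
  obtains E where "E \<in> sets M" "measure M E \<le> 1 / real N + measure M B"
    "AE x in M. \<exists>i<N. (\<theta> ^^ i) x \<in> E"
proof -
  \<comment> \<open>the level set \<open>\<tau> = k\<close> of the hitting time\<close>
  define H where "H k = {x \<in> space M. (\<theta> ^^ k) x \<in> B \<and> (\<forall>i<k. (\<theta> ^^ i) x \<notin> B)}" for k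
  have H_sets [measurable]: "H k \<in> sets M" for k
    unfolding H_def using B by measurable
  have H_unique: "k = l" if "x \<in> H k" "x \<in> H l" for x k l
    using that unfolding H_def by (metis (mono_tags, lifting) linorder_neqE_nat mem_Collect_eq)
  have H_step: "(\<theta> ^^ i) x \<in> H (k - i)" if "x \<in> H k" "i \<le> k" for x i k
  proof -
    have "(\<theta> ^^ l) ((\<theta> ^^ i) x) = (\<theta> ^^ (l + i)) x" for l
      by (simp add: funpow_add)
    then show ?thesis using that by (auto simp: H_def less_diff_conv)
  qed
  define E where "E = (\<Union>q. H (q * N))"
  \<comment> \<open>\<open>\<tau>\<close> is a positive multiple of \<open>N\<close>\<close>
  define E' where "E' = (\<Union>q\<in>{1..}. H (q * N))"
  have E_sets: "E \<in> sets M" "E' \<in> sets M"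
    unfolding E_def E'_def by auto
  have E_subset: "E \<subseteq> E' \<union> B"
  proof
    fix x assume "x \<in> E"
    then obtain q where q: "x \<in> H (q * N)" unfolding E_def by auto
    then show "x \<in> E' \<union> B"
      by (cases "q = 0") (auto simp: E'_def H_def Bex_def intro!: exI[of _ q])
  qed
  have "(\<theta> ^^ j) x \<notin> E'" if ij: "i < j" "j < N" and "(\<theta> ^^ i) x \<in> E'" for i j x
  proof
    assume "(\<theta> ^^ j) x \<in> E'"
    with \<open>(\<theta> ^^ i) x \<in> E'\<close> obtain p q where p: "p \<ge> 1" "(\<theta> ^^ i) x \<in> H (p * N)" and q: "(\<theta> ^^ j) x \<in> H (q * N)"
      unfolding E'_def by auto
    have "N \<le> p * N" using p(1) by simp
    then have "j - i \<le> p * N" using ij by linarith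
    then have "(\<theta> ^^ (j - i)) ((\<theta> ^^ i) x) \<in> H (p * N - (j - i))"
      using H_step p(2) by blast
    moreover have "(\<theta> ^^ (j - i)) ((\<theta> ^^ i) x) = (\<theta> ^^ j) x"
      using ij by (simp add: funpow_add[THEN fun_cong, symmetric, unfolded comp_def])
    ultimately have "p * N - (j - i) = q * N" using q H_unique by simp
    then have "j - i = p * N - q * N" using \<open>j - i \<le> p * N\<close> by linarith
    then have "N dvd j - i" by (simp add: diff_mult_distrib[symmetric])
    then show False using ij by (auto dest: dvd_imp_le)
  qed
  then have "real N * measure M E' \<le> 1"
    using disjoint_preimages_bound[OF E_sets(2)] by blast
  then have "measure M E' \<le> 1 / real N"
    using N by (simp add: field_simps)
  moreover have "measure M E \<le> measure M (E' \<union> B)"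
    using E_subset E_sets B by (intro finite_measure_mono) auto
  moreover have "measure M (E' \<union> B) \<le> measure M E' + measure M B"
    using E_sets B by (intro measure_subadditive) auto
  ultimately have small: "measure M E \<le> 1 / real N + measure M B" by linarith
  have "AE x in M. \<exists>i<N. (\<theta> ^^ i) x \<in> E"
    using AE_visits_infinitely_often[OF B pos] AE_space
  proof eventually_elim
    case (elim x)
    then obtain n where "(\<theta> ^^ n) x \<in> B" using INFM_EX by blast
    define k where "k = (LEAST n. (\<theta> ^^ n) x \<in> B)"
    have "x \<in> H k"
      using elim(2) LeastI[of "\<lambda>n. (\<theta> ^^ n) x \<in> B", OF \<open>(\<theta> ^^ n) x \<in> B\<close>]
      unfolding H_def k_def by (auto dest: not_less_Least)
    then have "(\<theta> ^^ (k mod N)) x \<in> H (k - k mod N)"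
      using H_step by simp
    then have "(\<theta> ^^ (k mod N)) x \<in> E"
      unfolding E_def by (auto simp: minus_mod_eq_div_mult)
    then show ?case using N mod_less_divisor by blast
  qed
  then show ?thesis using that E_sets small by blast
qed

end

section \<open>Absence of atoms\<close>

text \<open>
  Positive atoms are periodic points, which aperiodicity confines to a null set.  Hence the part
  isomorphic to an interval has full measure, and short intervals can be pulled back.
\<close>
lemma small_sets_in_aperiodic_lebesgue_space:
  fixes \<epsilon> :: real
  assumes "lebesgue_prob_space M" "measure_preserving M \<theta>" "aperiodic M \<theta>" and eps: "\<epsilon> > 0"
  obtains B where "B \<in> sets M" "measure M B > 0" "measure M B \<le> \<epsilon>"
proof -
  interpret prob_space M using assms(1) unfolding lebesgue_prob_space_def by simp
  interpret measure_preserving_system M \<theta> by unfold_locales fact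
  obtain N A C \<phi> where N: "N \<in> null_sets M" and A: "\<forall>a\<in>A. {a} \<in> sets M \<and> emeasure M {a} > 0"
    and C: "C \<in> sets M" and un: "N \<union> A \<union> C = space M"
    and iso: "measure_isomorphism \<phi> (restrict_space M C) (lebesgue_on {0..<measure M C})"
    using assms(1) unfolding lebesgue_prob_space_def by blast
  have "A = {}"
  proof (rule ccontr)
    assume "A \<noteq> {}"
    then obtain a where a: "a \<in> A" "{a} \<in> sets M" "emeasure M {a} > 0" using A by blast
    then have "\<exists>n\<ge>1. (\<theta> ^^ n) a = a"
      by (intro positive_atom_periodic) (auto simp: emeasure_eq_measure)
    then have "{a} \<subseteq> {x \<in> space M. \<exists>n\<ge>1. (\<theta> ^^ n) x = x}" using a un by auto
    then have "emeasure M {a} = 0"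
      using assms(3) a(2) null_sets_subset unfolding aperiodic_def by blast
    then show False using a by simp
  qed
  have "measure M C = 1"
  proof -
    have "AE x in M. x \<in> C" using N \<open>A = {}\<close> un by (intro AE_I'[OF N]) auto
    then show ?thesis using C by (simp add: prob_eq_1)
  qed
  define \<delta> where "\<delta> = min \<epsilon> 1"
  have \<delta>: "0 < \<delta>" "\<delta> \<le> 1" "\<delta> \<le> \<epsilon>" using eps by (auto simp: \<delta>_def)
  define B where "B = \<phi> -` {0..<\<delta>} \<inter> C"
  have spC: "space (restrict_space M C) = C"
    using sets.sets_into_space[OF C] by (auto simp: space_restrict_space)
  have \<phi>: "\<phi> \<in> measurable (restrict_space M C) (lebesgue_on {0..<1})"
    "distr (restrict_space M C) (lebesgue_on {0..<1}) \<phi> = lebesgue_on {0..<1}"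
    using iso \<open>measure M C = 1\<close> unfolding measure_isomorphism_def by auto
  have I: "{0..<\<delta>} \<in> sets (lebesgue_on {0..<1::real})"
    using \<delta> by (auto simp: sets_restrict_space_iff)
  have B_restr: "B \<in> sets (restrict_space M C)"
    using measurable_sets[OF \<phi>(1) I] unfolding B_def spC .
  then have B: "B \<in> sets M" "B \<subseteq> C" using C by (auto simp: sets_restrict_space_iff)
  have "emeasure M B = emeasure (restrict_space M C) B"
    using B C by (simp add: emeasure_restrict_space)
  also have "\<dots> = emeasure (distr (restrict_space M C) (lebesgue_on {0..<1}) \<phi>) {0..<\<delta>}"
    using \<phi>(1) I by (simp add: emeasure_distr B_def spC)
  also have "\<dots> = emeasure (lebesgue_on {0..<1}) {0..<\<delta>}" using \<phi>(2) by simp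
  also have "\<dots> = ennreal \<delta>"
    using \<delta> by (subst emeasure_restrict_space) auto
  finally have "measure M B = \<delta>" using \<delta> by (simp add: measure_def)
  then show ?thesis using that B \<delta> by auto
qed

section \<open>Averages of coboundaries\<close>

lemma koopman_funpow: "(koopman \<theta> ^^ k) f x = f ((\<theta> ^^ k) x)"
proof (induction k arbitrary: x)
  case (Suc k)
  have "(koopman \<theta> ^^ Suc k) f x = (koopman \<theta> ^^ k) f (\<theta> x)"
    by (simp add: koopman_def)
  then show ?case by (simp add: Suc funpow_swap1)
qed simp

lemma ergodic_average_coboundary:
  "ergodic_average \<theta> (\<lambda>x. g x - koopman \<theta> g x) n x = g x / real n - g ((\<theta> ^^ n) x) / real n"
proof -
  have "(\<Sum>k<n. (koopman \<theta> ^^ k) (\<lambda>x. g x - koopman \<theta> g x) x)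
      = (\<Sum>k<n. g ((\<theta> ^^ k) x) - g ((\<theta> ^^ Suc k) x))"
    by (simp add: koopman_funpow) (simp add: koopman_def)
  also have "\<dots> = g x - g ((\<theta> ^^ n) x)" by (subst sum_lessThan_telescope') simp
  finally show ?thesis unfolding ergodic_average_def by (simp add: diff_divide_distrib)
qed

text \<open>
  The two conditions force a limit of \<open>a n / n\<close> to be at least \<open>1\<close> and at most \<open>0\<close>.
\<close>
lemma not_convergent_if_large_and_bounded_infinitely_often:
  fixes a :: "nat \<Rightarrow> real"
  assumes large: "\<exists>\<^sub>\<infinity>n. a n \<ge> real n" and bdd: "\<exists>\<^sub>\<infinity>n. a n \<le> K"
  shows "\<not> convergent (\<lambda>n. c / real n - a n / real n)"
proof
  assume "convergent (\<lambda>n. c / real n - a n / real n)"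
  then obtain L where L: "(\<lambda>n. c / real n - a n / real n) \<longlonglongrightarrow> L"
    unfolding convergent_def by blast
  have "(\<lambda>n. c / real n - (c / real n - a n / real n)) \<longlonglongrightarrow> 0 - L"
    by (intro tendsto_diff L lim_const_over_n)
  then have lim: "(\<lambda>n. a n / real n) \<longlonglongrightarrow> - L" by simp
  have "1 \<le> - L"
  proof (rule ccontr)
    assume "\<not> ?thesis"
    then have "eventually (\<lambda>n. a n / real n < 1) sequentially"
      using lim by (intro order_tendstoD) auto
    then have "eventually (\<lambda>n. a n < real n) sequentially"
      using eventually_gt_at_top[of 0] by eventually_elim (simp add: field_simps)
    then have "eventually (\<lambda>n. \<not> a n \<ge> real n) sequentially"
      by eventually_elim simp
    then show False using large unfolding frequently_def cofinite_eq_sequentially by blast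
  qed
  moreover have "- L \<le> 0"
  proof (rule ccontr)
    assume "\<not> ?thesis"
    moreover have "(\<lambda>n. a n / real n - K / real n) \<longlonglongrightarrow> - L - 0"
      by (intro tendsto_diff lim lim_const_over_n)
    ultimately have "eventually (\<lambda>n. 0 < a n / real n - K / real n) sequentially"
      by (intro order_tendstoD(1)) auto
    then have "eventually (\<lambda>n. \<not> a n \<le> K) sequentially"
      using eventually_gt_at_top[of 0] by eventually_elim (simp add: field_simps)
    then show False using bdd unfolding frequently_def cofinite_eq_sequentially by blast
  qed
  ultimately show False by simp
qed

section \<open>The transfer function\<close>

text \<open>
  For heights \<open>N j\<close> growing fast enough and sweeping sets \<open>E j\<close> of measure at most \<open>2 / N j\<close>, the
  function \<open>h = (\<Sum>j. (N j)\<^sup>r \<cdot> indicator (E j))\<close> is integrable, and \<open>g = h\<^sup>1\<^sup>/\<^sup>r\<close> is at least \<open>N j\<close> on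
  \<open>E j\<close>.  Taking the root of a sum, rather than summing the functions
  \<open>N j \<cdot> indicator (E j)\<close>, makes \<open>\<integral>\<bar>g\<bar>\<^sup>r\<close> equal to \<open>\<integral>h\<close> and avoids the subadditivity of the power.
  An orbit meets \<open>E j\<close> at a time \<open>i < N j\<close>, where \<open>g\<close> is at least \<open>N j > i\<close>.
\<close>
lemma (in ergodic_system) Lr_function_with_large_orbit_values:
  assumes r: "0 < r" "r < 1"
    and small: "\<And>\<epsilon>::real. \<epsilon> > 0 \<Longrightarrow> \<exists>B\<in>sets M. measure M B > 0 \<and> measure M B \<le> \<epsilon>"
  obtains g where "g \<in> Lr_space r M" "AE x in M. \<exists>\<^sub>\<infinity>n. g ((\<theta> ^^ n) x) \<ge> real n"
proof -
  have "\<exists>n. n > j \<and> real n powr (r - 1) \<le> (1/2) ^ j" for j :: nat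
  proof -
    have "((\<lambda>n. real n powr (r - 1)) \<longlongrightarrow> 0) sequentially"
      using r by (intro tendsto_neg_powr filterlim_real_sequentially) auto
    then have "eventually (\<lambda>n. real n powr (r - 1) < (1/2) ^ j) sequentially"
      by (rule order_tendstoD) simp
    with eventually_gt_at_top[of j]
    have "eventually (\<lambda>n. n > j \<and> real n powr (r - 1) \<le> (1/2) ^ j) sequentially"
      by eventually_elim auto
    then show ?thesis using eventually_happens by force
  qed
  then obtain N where N: "\<And>j. N j > j" "\<And>j. real (N j) powr (r - 1) \<le> (1/2) ^ j"
    by metis
  have N0: "N j > 0" for j using N(1)[of j] by simp
  have "\<exists>E\<in>sets M. measure M E \<le> 2 / real (N j) \<and> (AE x in M. \<exists>i<N j. (\<theta> ^^ i) x \<in> E)" for j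
  proof -
    obtain B where B: "B \<in> sets M" "measure M B > 0" "measure M B \<le> 1 / real (N j)"
      using small[of "1 / real (N j)"] N0 by auto
    obtain E where "E \<in> sets M" "measure M E \<le> 1 / real (N j) + measure M B"
      "AE x in M. \<exists>i<N j. (\<theta> ^^ i) x \<in> E"
      using small_sweeping_set[OF B(1,2) N0] by blast
    moreover from this B(3) have "measure M E \<le> 2 / real (N j)" by simp
    ultimately show ?thesis by blast
  qed
  then have "\<forall>j. \<exists>E. E \<in> sets M \<and> measure M E \<le> 2 / real (N j) \<and>
      (AE x in M. \<exists>i<N j. (\<theta> ^^ i) x \<in> E)"
    by blast
  from choice[OF this] obtain E where E [measurable]: "\<And>j. E j \<in> sets M"
    and E_small: "\<And>j. measure M (E j) \<le> 2 / real (N j)"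
    and E_sweep: "\<And>j. AE x in M. \<exists>i<N j. (\<theta> ^^ i) x \<in> E j"
    by blast
  define h :: "'a \<Rightarrow> ennreal" where "h x = (\<Sum>j. ennreal (real (N j) powr r) * indicator (E j) x)" for x
  have h_meas [measurable]: "h \<in> borel_measurable M" unfolding h_def by measurable
  have term_le: "real (N j) powr r * measure M (E j) \<le> 2 * (1/2) ^ j" for j
  proof -
    have "real (N j) powr r * measure M (E j) \<le> real (N j) powr r * (2 / real (N j))"
      using E_small by (intro mult_left_mono) auto
    also have "\<dots> = 2 * real (N j) powr (r - 1)"
      using N0[of j] by (simp add: powr_diff)
    also have "\<dots> \<le> 2 * (1/2) ^ j" using N(2) by simp
    finally show ?thesis .
  qed
  have "(\<integral>\<^sup>+x. h x \<partial>M) = (\<Sum>j. ennreal (real (N j) powr r) * emeasure M (E j))"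
    unfolding h_def by (subst nn_integral_suminf) (auto simp: nn_integral_cmult_indicator)
  also have "\<dots> = (\<Sum>j. ennreal (real (N j) powr r * measure M (E j)))"
    by (simp add: emeasure_eq_measure ennreal_mult)
  also have "\<dots> \<le> (\<Sum>j. ennreal (2 * (1/2) ^ j))"
    using term_le by (intro suminf_le ennreal_leI) auto
  also have "\<dots> = ennreal (\<Sum>j. 2 * (1/2) ^ j)"
    by (intro suminf_ennreal2 summable_mult summable_geometric) auto
  finally have h_int: "(\<integral>\<^sup>+x. h x \<partial>M) < \<infinity>"
    by (auto simp: less_top[symmetric] top_unique)
  then have h_fin: "AE x in M. h x \<noteq> \<infinity>"
    by (intro nn_integral_PInf_AE) auto
  \<comment> \<open>\<open>enn2real\<close> sends \<open>\<infinity>\<close> to \<open>0\<close>; this affects only a null set\<close>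
  define g where "g x = enn2real (h x) powr (1 / r)" for x
  have "(\<integral>\<^sup>+x. ennreal (\<bar>g x\<bar> powr r) \<partial>M) \<le> (\<integral>\<^sup>+x. h x \<partial>M)"
  proof (rule nn_integral_mono)
    fix x
    have "\<bar>g x\<bar> powr r = enn2real (h x)" using r by (simp add: g_def powr_powr)
    then show "ennreal (\<bar>g x\<bar> powr r) \<le> h x"
      by (cases "h x") (auto)
  qed
  moreover have "g \<in> borel_measurable M" unfolding g_def by measurable
  ultimately have "g \<in> Lr_space r M" using h_int unfolding Lr_space_def by auto
  have g_ge: "g y \<ge> real (N j)" if "y \<in> E j" "h y \<noteq> \<infinity>" for y j
  proof -
    have "(\<Sum>i\<in>{j}. ennreal (real (N i) powr r) * indicator (E i) y) \<le> h y"
      unfolding h_def by (rule sum_le_suminf) auto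
    then have "ennreal (real (N j) powr r) \<le> h y" using that by simp
    then have "real (N j) powr r \<le> enn2real (h y)"
      using that(2) by (cases "h y") auto
    then have "(real (N j) powr r) powr (1 / r) \<le> g y"
      unfolding g_def using r by (intro powr_mono2) auto
    then show ?thesis using r by (simp add: powr_powr)
  qed
  have "AE x in M. \<forall>j. \<exists>i<N j. (\<theta> ^^ i) x \<in> E j"
    using E_sweep by (simp add: AE_all_countable)
  then have "AE x in M. \<exists>\<^sub>\<infinity>n. g ((\<theta> ^^ n) x) \<ge> real n"
    using AE_all_iterates[OF h_fin]
  proof eventually_elim
    case (elim x)
    show ?case unfolding INFM_nat_le
    proof
      fix m
      \<comment> \<open>\<open>N j\<close> exceeds the first \<open>m\<close> values of \<open>g\<close> along the orbit, so \<open>E j\<close> is met at a later time\<close>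
      obtain j where j: "(\<Sum>i<m. \<bar>g ((\<theta> ^^ i) x)\<bar>) < real j" using reals_Archimedean2 by blast
      obtain i where i: "i < N j" "(\<theta> ^^ i) x \<in> E j" using elim(1) by blast
      then have gi: "g ((\<theta> ^^ i) x) \<ge> real (N j)" using g_ge elim(2) by blast
      have "i \<ge> m"
      proof (rule ccontr)
        assume "\<not> i \<ge> m"
        then have "\<bar>g ((\<theta> ^^ i) x)\<bar> \<le> (\<Sum>i<m. \<bar>g ((\<theta> ^^ i) x)\<bar>)"
          by (intro member_le_sum) auto
        then show False using gi j N(1)[of j] by simp
      qed
      moreover have "g ((\<theta> ^^ i) x) \<ge> real i" using gi i(1) by simp
      ultimately show "\<exists>n\<ge>m. g ((\<theta> ^^ n) x) \<ge> real n" by blast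
    qed
  qed
  then show ?thesis using that \<open>g \<in> Lr_space r M\<close> by blast
qed

text \<open>
  The sublevel sets of \<open>g\<close> at natural numbers exhaust the space, so one of them has positive measure,
  and almost every orbit returns to it.
\<close>
lemma (in ergodic_system) AE_bounded_infinitely_often:
  fixes g :: "'a \<Rightarrow> real"
  assumes [measurable]: "g \<in> borel_measurable M"
  obtains K :: real where "AE x in M. \<exists>\<^sub>\<infinity>n. g ((\<theta> ^^ n) x) \<le> K"
proof -
  have "\<exists>K::nat. measure M {x \<in> space M. g x \<le> real K} > 0"
  proof (rule ccontr)
    assume "\<not> ?thesis"
    then have "{x \<in> space M. g x \<le> real K} \<in> null_sets M" for K :: nat
      by (auto simp: null_sets_def emeasure_eq_measure zero_less_measure_iff)
    then have "(\<Union>K::nat. {x \<in> space M. g x \<le> real K}) \<in> null_sets M" by blast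
    moreover have "(\<Union>K::nat. {x \<in> space M. g x \<le> real K}) = space M"
      using real_arch_simple by auto
    ultimately show False using emeasure_space_1 by auto
  qed
  then obtain K :: nat where K: "measure M {x \<in> space M. g x \<le> real K} > 0" by blast
  have "AE x in M. \<exists>\<^sub>\<infinity>n. (\<theta> ^^ n) x \<in> {x \<in> space M. g x \<le> real K}"
    by (rule AE_visits_infinitely_often[OF _ K]) measurable
  then have "AE x in M. \<exists>\<^sub>\<infinity>n. g ((\<theta> ^^ n) x) \<le> real K"
    by eventually_elim (auto elim: frequently_elim1)
  then show ?thesis using that by blast
qed

theorem proposition2p9:
  fixes M :: "'a measure" and \<theta> :: "'a \<Rightarrow> 'a"
  assumes "lebesgue_prob_space M"
    and "measure_preserving M \<theta>"
    and "ergodic M \<theta>"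
    and "aperiodic M \<theta>"
  shows "\<forall>r::real. 0 < r \<and> r < 1 \<longrightarrow>
           (\<exists>f \<in> coboundaries r M \<theta>.
              \<not> (AE x in M. convergent (\<lambda>n. ergodic_average \<theta> f n x)))"
proof (intro allI impI)
  fix r :: real assume r: "0 < r \<and> r < 1"
  interpret prob_space M using assms(1) unfolding lebesgue_prob_space_def by simp
  interpret ergodic_system M \<theta> by unfold_locales fact+
  have "\<exists>B\<in>sets M. measure M B > 0 \<and> measure M B \<le> \<epsilon>" if "\<epsilon> > 0" for \<epsilon> :: real
    using small_sets_in_aperiodic_lebesgue_space[OF assms(1,2,4) that] by blast
  then obtain g where g: "g \<in> Lr_space r M" and large: "AE x in M. \<exists>\<^sub>\<infinity>n. g ((\<theta> ^^ n) x) \<ge> real n"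
    using Lr_function_with_large_orbit_values r by blast
  obtain K where bdd: "AE x in M. \<exists>\<^sub>\<infinity>n. g ((\<theta> ^^ n) x) \<le> K"
    using AE_bounded_infinitely_often g unfolding Lr_space_def by blast
  let ?f = "\<lambda>x. g x - koopman \<theta> g x"
  have div: "AE x in M. \<not> convergent (\<lambda>n. ergodic_average \<theta> ?f n x)"
    using large bdd
  proof eventually_elim
    case (elim x)
    then show ?case
      unfolding ergodic_average_coboundary
      by (rule not_convergent_if_large_and_bounded_infinitely_often)
  qed
  have "\<not> (AE x in M. convergent (\<lambda>n. ergodic_average \<theta> ?f n x))"
  proof
    assume "AE x in M. convergent (\<lambda>n. ergodic_average \<theta> ?f n x)"
    with div have "AE x in M. False" by eventually_elim simp
    then show False by simp
  qed
  moreover have "?f \<in> coboundaries r M \<theta>" using g unfolding coboundaries_def by blast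
  ultimately show "\<exists>f\<in>coboundaries r M \<theta>. \<not> (AE x in M. convergent (\<lambda>n. ergodic_average \<theta> f n x))"
    by blast
qed

end
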